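(* Let $X$ be a topological space and let $Y$ be a metrizable ANR (absolute neighborhood retract). Then $$\mathrm{B}_1(X,Y)=\mathrm{hB}_1(X,Y).$$ Moreover, every $f\in \mathrm{B}_1(X,Y)$ is a pointwise limit of a sequence of null-homotopic continuous maps $X\to Y$.
   Context: For topological spaces $X$ and $Y$: a map $f:X\to Y$ (not necessarily continuous) is a Baire-one map if there is a sequence $(f_n)_{n\in\omega}$ of continuous maps $f_n:X\to Y$ with $\lim_{n\to\infty} f_n(x)=f(x)$ for every $x\in X$; $\mathrm{B}_1(X,Y)$ denotes the set of all Baire-one maps $X\to Y$. A map $f:X\to Y$ is a homotopical Baire-one map if there is a sequence $(f_n)_{n\in\omega}$ of pairwise homotopic continuous maps $f_n:X\to Y$ with $\lim_{n\to\infty} f_n(x)=f(x)$ for every $x\in X$; equivalently, there is a continuous map $H:X\times[0,+\infty)\to Y$ such that $\lim_{n\to\infty}H(x,n)=f(x)$ for every $x\in X$. $\mathrm{hB}_1(X,Y)$ denotes the set of all homotopical Baire-one maps $X\to Y$. A continuous map is null-homotopic if it is homotopic to a constant map.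
   Formalization: The formal theorem additionally assumes that X or Y is connected; without this the claim is false (identity of the discrete two-point space), and the "Moreover" part fails whenever both X and Y are disconnected. *)

theory Defs
  imports "HOL-Analysis.Analysis"
begin

definition pointwise_limit ::
  "'a topology \<Rightarrow> 'b topology \<Rightarrow> (nat \<Rightarrow> 'a \<Rightarrow> 'b) \<Rightarrow> ('a \<Rightarrow> 'b) \<Rightarrow> bool" where
  "pointwise_limit X Y g f \<longleftrightarrow>
     (\<forall>x \<in> topspace X. limitin Y (\<lambda>n. g n x) (f x) sequentially)"

text \<open>
  Maps are total functions whose values outside \<^term>\<open>topspace X\<close> are irrelevant.  That the
  limit maps \<^term>\<open>topspace X\<close> into \<^term>\<open>topspace Y\<close> is part of \<^const>\<open>limitin\<close>.
\<close>

definition Baire_one :: "'a topology \<Rightarrow> 'b topology \<Rightarrow> ('a \<Rightarrow> 'b) set" where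
  "Baire_one X Y =
     {f. \<exists>g. (\<forall>n. continuous_map X Y (g n)) \<and> pointwise_limit X Y g f}"

definition homotopical_Baire_one :: "'a topology \<Rightarrow> 'b topology \<Rightarrow> ('a \<Rightarrow> 'b) set" where
  "homotopical_Baire_one X Y =
     {f. \<exists>g. (\<forall>n. continuous_map X Y (g n)) \<and>
             (\<forall>m n. homotopic_with (\<lambda>_. True) X Y (g m) (g n)) \<and>
             pointwise_limit X Y g f}"

text \<open>
  If X is nonempty then the constant \<open>c\<close> below is automatically a point of Y; if X is empty
  then the empty map counts as constant, also when Y is empty.
\<close>

definition null_homotopic :: "'a topology \<Rightarrow> 'b topology \<Rightarrow> ('a \<Rightarrow> 'b) \<Rightarrow> bool" where
  "null_homotopic X Y f \<longleftrightarrow> (\<exists>c. homotopic_with (\<lambda>_. True) X Y f (\<lambda>x. c))"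

text \<open>
  A metrizable ANR is a metrizable space that is a neighbourhood retract of every metrizable
  space Z containing a homeomorphic copy of it as a closed subspace.  The library's
  \<^const>\<open>ANR\<close> only tests ambient spaces of type \<open>'a \<times> real\<close> and is adequate for subsets of
  Euclidean spaces only.  A definition in HOL cannot quantify over the type of points of Z, so
  Z ranges over all metrizable spaces with points in \<open>'b \<Rightarrow> real\<close>.  This loses nothing: by
  Kuratowski and Wojdyslawski, Y embeds as a closed subset of a convex subset of the normed
  space of bounded real functions on Y, which is such a Z; and by Dugundji's extension theorem
  a neighbourhood retract of a convex subset of a normed space is a neighbourhood retract of
  every metrizable space, of whatever type, in which it is closed.
\<close>

definition metrizable_ANR :: "'b topology \<Rightarrow> bool" where
  "metrizable_ANR Y \<longleftrightarrow>
     metrizable_space Y \<and>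
     (\<forall>(Z :: ('b \<Rightarrow> real) topology) S.
        metrizable_space Z \<and> closedin Z S \<and> subtopology Z S homeomorphic_space Y \<longrightarrow>
        (\<exists>U. openin Z U \<and> S \<subseteq> U \<and> S retract_of_space (subtopology Z U)))"

text \<open>
  If neither X nor Y is connected, some Baire-one (even continuous) map is not a pointwise
  limit of null-homotopic maps: a null-homotopic map cannot meet both parts of a separation of Y.
  So the theorem needs X or Y to be connected; for example it fails for the identity of a
  discrete two-point space, which is an ANR.
\<close>

lemma null_homotopic_same_side:
  assumes g: "null_homotopic X Y g" and x: "x \<in> topspace X" and y: "y \<in> topspace X"
    and A: "openin Y A" and B: "openin Y B" and AB: "A \<inter> B = {}" "topspace Y \<subseteq> A \<union> B"
    and gx: "g x \<in> A"
  shows "g y \<notin> B"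
proof
  assume gy: "g y \<in> B"
  obtain c where "homotopic_with (\<lambda>_. True) X Y g (\<lambda>x. c)"
    using g by (auto simp: null_homotopic_def)
  then obtain h where h: "continuous_map (prod_topology (top_of_set {0..1::real}) X) Y h"
    and h0: "\<And>x. h (0, x) = g x" and h1: "\<And>x. h (1, x) = c"
    unfolding homotopic_with_def by blast
  have conn: "connectedin Y ((\<lambda>t. h (t, z)) ` {0..1})" if "z \<in> topspace X" for z
  proof -
    have "continuous_map (top_of_set {0..1::real}) Y (h \<circ> (\<lambda>t. (t, z)))"
      by (rule continuous_map_compose[OF _ h])
        (use that in \<open>auto intro!: continuous_map_pairedI\<close>)
    from connectedin_continuous_map_image[OF this, of "{0..1}"] show ?thesis
      by (simp add: connectedin_subtopology comp_def)
  qed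
  have side: "(\<lambda>t. h (t, z)) ` {0..1} \<inter> A = {} \<or> (\<lambda>t. h (t, z)) ` {0..1} \<inter> B = {}"
    if "z \<in> topspace X" for z
  proof (rule ccontr)
    let ?C = "(\<lambda>t. h (t, z)) ` {0..1}"
    assume "\<not> (?C \<inter> A = {} \<or> ?C \<inter> B = {})"
    moreover have "?C \<subseteq> A \<union> B"
      using connectedin_subset_topspace[OF conn[OF that]] AB(2) by (rule order_trans)
    ultimately show False
      using connectedinD[OF conn[OF that] A B] AB(1) by (simp add: Int_commute)
  qed
  have mem: "h (0, z) \<in> (\<lambda>t. h (t, z)) ` {0..1}" "h (1, z) \<in> (\<lambda>t. h (t, z)) ` {0..1}" for z
    by auto
  have "c \<in> topspace Y"
    using connectedin_subset_topspace[OF conn[OF x]] mem(2)[of x] unfolding h1 by (rule subsetD)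
  then have "c \<in> A \<or> c \<in> B"
    using AB by auto
  then show False
    using side[OF x] side[OF y] mem[of x] mem[of y] gx gy unfolding h0 h1 by blast
qed

lemma connectedness_is_necessary:
  assumes "\<not> connected_space X" and "\<not> connected_space Y"
  shows "\<exists>f \<in> Baire_one X Y. \<nexists>g. (\<forall>n. null_homotopic X Y (g n)) \<and> pointwise_limit X Y g f"
proof -
  obtain U V where UV: "openin X U" "openin X V" "topspace X \<subseteq> U \<union> V" "U \<inter> V = {}" "U \<noteq> {}" "V \<noteq> {}"
    using assms(1) unfolding connected_space_def by blast
  obtain A B where AB: "openin Y A" "openin Y B" "topspace Y \<subseteq> A \<union> B" "A \<inter> B = {}" "A \<noteq> {}" "B \<noteq> {}"
    using assms(2) unfolding connected_space_def by blast
  obtain a b x y where ab: "a \<in> A" "b \<in> B" "x \<in> U" "y \<in> V"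
    using UV AB by blast
  have abY: "a \<in> topspace Y" "b \<in> topspace Y" and xyX: "x \<in> topspace X" "y \<in> topspace X"
    using ab AB UV by (auto dest: openin_subset)
  define f where "f = (\<lambda>z. if z \<in> U then a else b)"
  have "openin X {z \<in> topspace X. f z \<in> W}" for W
  proof -
    have "{z \<in> topspace X. f z \<in> W} = (if a \<in> W then U else {}) \<union> (if b \<in> W then V else {})"
      using UV openin_subset[OF UV(1)] openin_subset[OF UV(2)] by (auto simp: f_def)
    then show ?thesis
      using UV by auto
  qed
  then have cont: "continuous_map X Y f"
    using abY by (auto simp: continuous_map_def f_def)
  have "f \<in> Baire_one X Y"
    unfolding Baire_one_def pointwise_limit_def
    using cont abY by (auto intro!: exI[of _ "\<lambda>_. f"] simp: f_def)
  moreover have False if g: "\<forall>n. null_homotopic X Y (g n)" "pointwise_limit X Y g f" for g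
  proof -
    have f: "f x \<in> A" "f y \<in> B"
      using ab UV by (auto simp: f_def)
    have "\<forall>\<^sub>F n in sequentially. g n x \<in> A" "\<forall>\<^sub>F n in sequentially. g n y \<in> B"
      using g(2) xyX AB f unfolding pointwise_limit_def limitin_def by blast+
    then have "\<forall>\<^sub>F n in sequentially. g n x \<in> A \<and> g n y \<in> B"
      by (rule eventually_conj)
    then obtain n where "g n x \<in> A" "g n y \<in> B"
      using eventually_happens'[OF sequentially_bot] by blast
    then show False
      using null_homotopic_same_side[OF spec[OF g(1)] xyX AB(1,2,4,3)] by blast
  qed
  ultimately show ?thesis
    by blast
qed

end

theory Submission
  imports Defs
begin

text \<open>
  Let \<open>f\<close> be the pointwise limit of continuous maps \<open>f n\<close>.  The homotopy class of \<open>f n\<close> depends on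
  the map as a whole, whereas convergence is tested one point at a time.  So \<open>f n\<close> may be
  changed on a region that every point of \<open>X\<close> eventually leaves.  The change made here cuts \<open>X\<close>
  into a closed set sent to a point \<open>b\<close> and finitely many closed pieces, each mapped by \<open>f n\<close> into
  an open set that contracts in \<open>Y\<close> to \<open>b\<close>, and runs these contractions near the borders of the
  pieces, so that the new map \<open>g n\<close> equals \<open>b\<close> on the borders (\<open>null_homotopic_pasting\<close>).  Running
  the contractions to their end everywhere shows that \<open>g n\<close> is null-homotopic.  As all \<open>g n\<close> are
  homotopic to the same constant map, they are pairwise homotopic.

  The pieces must be chosen such that each \<open>x\<close> is away from the borders for all large \<open>n\<close>.  This works
  when every value of \<open>f\<close> lies in one of countably many open sets contracting to \<open>b\<close>: then the
  sequence \<open>f n x\<close> satisfies one of countably many closed conditions, any violation of which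
  shows at a finite stage, and stage \<open>n\<close> follows the first condition not refuted so far
  (\<open>limit_of_null_homotopic\<close>).  A cover by arbitrarily many contracting sets becomes countable by Stone's
  argument, because a disjoint union of open sets contracting to \<open>b\<close> contracts to \<open>b\<close>
  (\<open>Union_contracts_in_countable\<close>).

  Points of an ANR have neighbourhoods that contract in the space: embed it as a closed subset of a
  cone of functions and push the segments of the cone back by a neighbourhood retraction
  (\<open>ANR_semilocally_contractible_at\<close>).  Hence path components are open, and the connectedness
  hypothesis places all values of \<open>f\<close> in one of them, which permits a common end point \<open>b\<close>
  (\<open>Baire_one_path_component\<close>).
\<close>

section \<open>Open sets that contract to a point\<close>

text \<open>
  The contraction takes place in \<open>Y\<close> and may leave \<open>V\<close>, and \<open>b\<close> may lie outside \<open>V\<close>: disjoint sets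
  can contract to the same point.
\<close>

definition contracts_in :: "'b topology \<Rightarrow> 'b set \<Rightarrow> 'b \<Rightarrow> bool" where
  "contracts_in Y V b \<longleftrightarrow> homotopic_with (\<lambda>_. True) (subtopology Y V) Y (\<lambda>y. y) (\<lambda>_. b)"

lemma contracts_in_subset:
  assumes "contracts_in Y V b" "W \<subseteq> V"
  shows "contracts_in Y W b"
proof -
  have "continuous_map (subtopology Y W) (subtopology Y V) id"
    by (rule continuous_map_into_subtopology[OF continuous_map_from_subtopology[OF continuous_map_id]])
      (use assms(2) in auto)
  from homotopic_with_compose_continuous_map_right[OF assms(1)[unfolded contracts_in_def] this]
  show ?thesis
    by (simp add: contracts_in_def comp_def)
qed

lemma contracts_in_path_component:
  assumes "contracts_in Y V a" "path_component_of Y a b"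
  shows "contracts_in Y V b"
proof -
  have "homotopic_with (\<lambda>_. True) (subtopology Y V) Y (\<lambda>_. a) (\<lambda>_. b)"
    using assms(2) by (simp add: homotopic_constant_maps)
  then show ?thesis
    using assms(1) unfolding contracts_in_def by (rule homotopic_with_trans[rotated])
qed

lemma path_component_of_contraction:
  assumes V: "contracts_in Y V b" and y: "y \<in> V" "y \<in> topspace Y"
  shows "path_component_of Y y b"
proof -
  have "continuous_map (top_of_set {0::real}) (subtopology Y V) (\<lambda>_. y)"
    using y by simp
  from homotopic_with_compose_continuous_map_right[OF V[unfolded contracts_in_def] this]
  have "homotopic_with (\<lambda>_. True) (top_of_set {0::real}) Y (\<lambda>_. y) (\<lambda>_. b)"
    by (simp add: comp_def)
  then show ?thesis
    unfolding homotopic_constant_maps by (simp flip: null_topspace_iff_trivial)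
qed

text \<open>
  The contraction of \<open>V\<close> may run through all of \<open>Y\<close>, whereas in a locally contractible space it can be
  kept inside a prescribed neighbourhood of \<open>y\<close>.
\<close>

definition semilocally_contractible :: "'b topology \<Rightarrow> bool" where
  "semilocally_contractible Y \<longleftrightarrow>
     (\<forall>y \<in> topspace Y. \<exists>V. openin Y V \<and> y \<in> V \<and> contracts_in Y V y)"

section \<open>Local contractibility of metrizable ANRs\<close>

context Metric_space
begin

lemma continuous_map_dist:
  assumes "continuous_map X mtopology f" "continuous_map X mtopology g"
  shows "continuous_map X euclideanreal (\<lambda>x. d (f x) (g x))"
  using continuous_map_mdist[of X "metric (M, d)" f g] assms by simp

text \<open>
  The point at parameter \<open>s\<close> of the segment from \<open>0\<close> to the Kuratowski image \<open>d y - d a\<close> of \<open>y\<close>.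
  Subtracting \<open>d a\<close> makes these functions bounded even when \<open>d\<close> is not, and places the image
  of \<open>a\<close> at the origin.  The restriction to \<open>M\<close> is what membership in \<^const>\<open>Metric_space.fspace\<close> asks for.
\<close>

definition ray :: "'a \<Rightarrow> real \<Rightarrow> 'a \<Rightarrow> 'a \<Rightarrow> real" where
  "ray a s y = (\<lambda>u\<in>M. s * (d y u - d a u))"

lemma ray_in_fspace:
  assumes "a \<in> M" "y \<in> M"
  shows "ray a s y \<in> Met_TC.fspace M"
proof -
  have "\<bar>d y u - d a u\<bar> \<le> d y a" if "u \<in> M" for u
    using assms that by (smt (verit, best) commute triangle)
  then have "\<bar>s * (d y u - d a u)\<bar> \<le> \<bar>s\<bar> * d y a" if "u \<in> M" for u
    using that by (simp add: abs_mult mult_left_mono)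
  then have "ray a s y ` M \<subseteq> cball 0 (\<bar>s\<bar> * d y a)"
    by (auto simp: ray_def)
  then show ?thesis
    using bounded_subset[OF bounded_cball] by (auto simp: Met_TC.fspace_def ray_def)
qed

lemma fdist_ray_le:
  assumes "a \<in> M" "y \<in> M" "z \<in> M" "0 \<le> s"
  shows "Met_TC.fdist M (ray a s y) (ray a t z) \<le> s * d y z + \<bar>s - t\<bar> * d a z"
proof -
  have "dist (ray a s y u) (ray a t z u) \<le> s * d y z + \<bar>s - t\<bar> * d a z" if u: "u \<in> M" for u
  proof -
    have "\<bar>d y u - d z u\<bar> \<le> d y z" "\<bar>d z u - d a u\<bar> \<le> d a z"
      using assms u by (smt (verit, best) commute triangle)+
    then have "\<bar>s * (d y u - d z u)\<bar> + \<bar>(s - t) * (d z u - d a u)\<bar> \<le> s * d y z + \<bar>s - t\<bar> * d a z"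
      using \<open>0 \<le> s\<close> by (simp add: abs_mult add_mono mult_left_mono)
    moreover have "ray a s y u - ray a t z u = s * (d y u - d z u) + (s - t) * (d z u - d a u)"
      using u by (simp add: ray_def algebra_simps)
    ultimately show ?thesis
      by (simp add: dist_real_def)
  qed
  then show ?thesis
    using assms by (subst Met_TC.funspace_mdist_le) (auto simp: ray_in_fspace)
qed

lemma ray_diff_le_fdist:
  assumes "a \<in> M" "y \<in> M" "z \<in> M" "u \<in> M"
  shows "\<bar>ray a s y u - ray a t z u\<bar> \<le> Met_TC.fdist M (ray a s y) (ray a t z)"
proof -
  have "\<forall>u\<in>M. dist (ray a s y u) (ray a t z u) \<le> Met_TC.fdist M (ray a s y) (ray a t z)"
    using assms by (subst Met_TC.funspace_mdist_le[symmetric]) (auto simp: ray_in_fspace)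
  then show ?thesis
    using assms by (simp add: dist_real_def)
qed

lemma fdist_ray_one:
  assumes "a \<in> M" "y \<in> M" "z \<in> M"
  shows "Met_TC.fdist M (ray a 1 y) (ray a 1 z) = d y z"
proof (rule antisym)
  show "Met_TC.fdist M (ray a 1 y) (ray a 1 z) \<le> d y z"
    using fdist_ray_le[of a y z 1 1] assms by simp
  show "d y z \<le> Met_TC.fdist M (ray a 1 y) (ray a 1 z)"
    using ray_diff_le_fdist[of a y z z 1 1] assms by (simp add: ray_def)
qed

text \<open>
  The quantitative reason why \<open>M\<close> is closed in the cone over it: evaluating at \<open>w\<close> itself, where
  the image of \<open>w\<close> is smallest, bounds the distance below by \<open>s * d y w + (1 - s) * d a w\<close>, and \<open>w\<close>
  cannot be close to both \<open>y\<close> and \<open>a\<close>.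
\<close>

lemma fdist_ray_one_ge:
  assumes "a \<in> M" "y \<in> M" "w \<in> M" "0 \<le> s" "s \<le> 1"
  shows "min s (1 - s) * d y a \<le> Met_TC.fdist M (ray a s y) (ray a 1 w)"
proof -
  have "min s (1 - s) * d y a \<le> min s (1 - s) * (d y w + d a w)"
    using assms by (intro mult_left_mono) (auto simp: commute[of a] intro: triangle)
  also have "\<dots> \<le> s * d y w + (1 - s) * d a w"
    by (simp add: distrib_left add_mono mult_right_mono)
  also have "\<dots> = ray a s y w - ray a 1 w w"
    using assms by (simp add: ray_def algebra_simps)
  also have "\<dots> \<le> Met_TC.fdist M (ray a s y) (ray a 1 w)"
    using ray_diff_le_fdist[of a y w w s 1] assms by linarith
  finally show ?thesis .
qed

abbreviation ray_topology :: "('a \<Rightarrow> real) topology" where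
  "ray_topology \<equiv> Metric_space.mtopology (Met_TC.fspace M) (Met_TC.fdist M)"

lemma continuous_map_ray:
  assumes a: "a \<in> M"
  shows "continuous_map (prod_topology (top_of_set {0..1}) mtopology) ray_topology
           (\<lambda>(s, y). ray a s y)" (is "continuous_map ?P _ _")
proof -
  interpret F: Metric_space "Met_TC.fspace M" "Met_TC.fdist M :: ('a \<Rightarrow> real) \<Rightarrow> _"
    by (rule Met_TC.Metric_space_funspace)
  show ?thesis
    unfolding F.continuous_map_to_metric
  proof (intro ballI allI impI)
    fix p and \<epsilon> :: real
    assume p: "p \<in> topspace ?P" and "0 < \<epsilon>"
    obtain t z where pz: "p = (t, z)" "z \<in> M" "0 \<le> t" "t \<le> 1"
      using p by auto
    define \<delta> where "\<delta> = (\<lambda>q. fst q * d (snd q) z + \<bar>fst q - t\<bar> * d a z)"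
    have fst: "continuous_map ?P euclideanreal fst"
      by (rule continuous_map_into_fulltopology[OF continuous_map_fst])
    have "continuous_map ?P euclideanreal \<delta>"
      unfolding \<delta>_def
      by (intro continuous_intros fst continuous_map_dist continuous_map_snd) (auto simp: pz a)
    then have "openin ?P {q \<in> topspace ?P. \<delta> q \<in> {..<\<epsilon>}}"
      by (rule openin_continuous_map_preimage) auto
    moreover have "p \<in> {q \<in> topspace ?P. \<delta> q \<in> {..<\<epsilon>}}"
      using p pz \<open>0 < \<epsilon>\<close> by (simp add: \<delta>_def)
    moreover have "(case q of (s, y) \<Rightarrow> ray a s y) \<in> F.mball (case p of (s, y) \<Rightarrow> ray a s y) \<epsilon>"
      if "q \<in> {q \<in> topspace ?P. \<delta> q \<in> {..<\<epsilon>}}" for q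
    proof -
      obtain s y where q: "q = (s, y)" by fastforce
      have *: "y \<in> M" "0 \<le> s" "\<delta> q < \<epsilon>"
        using that by (auto simp: q)
      have "Met_TC.fdist M (ray a s y) (ray a t z) < \<epsilon>"
        using fdist_ray_le[of a y z s t] a pz * by (simp add: \<delta>_def q)
      then show ?thesis
        using a pz * by (simp add: q ray_in_fspace F.commute)
    qed
    ultimately show "\<exists>U. openin ?P U \<and> p \<in> U \<and>
        (\<forall>q\<in>U. (case q of (s, y) \<Rightarrow> ray a s y) \<in> F.mball (case p of (s, y) \<Rightarrow> ray a s y) \<epsilon>)"
      by blast
  qed
qed

text \<open>
  The union of all segments from the image of \<open>a\<close> to the image of \<open>M\<close>.  It replaces the convex hull
  of the usual Kuratowski--Wojdyslawski embedding: only segments ending at \<open>a\<close> are needed to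
  contract a neighbourhood to \<open>a\<close>, and in this smaller set \<open>fdist_ray_one_ge\<close> shows \<open>M\<close> to be closed.
\<close>

definition ray_cone :: "'a \<Rightarrow> ('a \<Rightarrow> real) set" where
  "ray_cone a = (\<lambda>(s, y). ray a s y) ` ({0..1} \<times> M)"

lemma closedin_base_of_ray_cone:
  assumes a: "a \<in> M"
  shows "closedin (subtopology ray_topology (ray_cone a)) (ray a 1 ` M)"
proof -
  interpret F: Metric_space "Met_TC.fspace M" "Met_TC.fdist M :: ('a \<Rightarrow> real) \<Rightarrow> _"
    by (rule Met_TC.Metric_space_funspace)
  have ray0: "ray a 0 y = ray a 1 a" if "y \<in> M" for y
    using that by (auto simp: ray_def)
  have sub: "ray_cone a \<subseteq> Met_TC.fspace M"
    using ray_in_fspace[OF a] by (auto simp: ray_cone_def)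
  \<comment> \<open>Outside the base one has \<open>0 < s < 1\<close> and \<open>y \<noteq> a\<close>: the apex and all rays over \<open>a\<close> are the image of \<open>a\<close>.\<close>
  have nbhd: "\<exists>\<epsilon>>0. F.mball p \<epsilon> \<inter> ray a 1 ` M = {}"
    if p: "p \<in> ray_cone a" "p \<notin> ray a 1 ` M" for p
  proof -
    obtain s y where sy: "p = ray a s y" "0 \<le> s" "s \<le> 1" "y \<in> M"
      using p(1) by (auto simp: ray_cone_def)
    have "s \<noteq> 0" "s \<noteq> 1"
      using p(2) sy a ray0 by auto
    moreover have "y \<noteq> a"
    proof
      assume "y = a"
      then have "p = ray a 1 a"
        using sy(1) by (auto simp: ray_def)
      then show False using p(2) a by blast
    qed
    ultimately have "0 < min s (1 - s) * d y a"
      using sy a by (simp add: less_le)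
    moreover have "F.mball p (min s (1 - s) * d y a) \<inter> ray a 1 ` M = {}"
      using fdist_ray_one_ge[OF a sy(4) _ sy(2,3)] sy(1) by fastforce
    ultimately show ?thesis by blast
  qed
  define W where "W = \<Union>{F.mball p \<epsilon> |p \<epsilon>. F.mball p \<epsilon> \<inter> ray a 1 ` M = {}}"
  have "openin F.mtopology W"
    unfolding W_def by (intro openin_Union) auto
  moreover have "ray_cone a - ray a 1 ` M = ray_cone a \<inter> W"
  proof -
    have "p \<in> W" if p: "p \<in> ray_cone a" "p \<notin> ray a 1 ` M" for p
    proof -
      obtain \<epsilon> where e: "0 < \<epsilon>" "F.mball p \<epsilon> \<inter> ray a 1 ` M = {}"
        using nbhd[OF p] by blast
      moreover have "p \<in> F.mball p \<epsilon>"
        using e(1) p(1) sub by (meson F.centre_in_mball_iff subsetD)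
      ultimately show ?thesis
        unfolding W_def by blast
    qed
    moreover have "W \<inter> ray a 1 ` M = {}"
      unfolding W_def by blast
    ultimately show ?thesis by blast
  qed
  moreover have "ray a 1 ` M \<subseteq> ray_cone a"
    by (auto simp: ray_cone_def)
  ultimately show ?thesis
    using sub unfolding closedin_def by (auto simp: openin_subtopology_Int2 Int_absorb1)
qed

text \<open>
  The cone over \<open>M\<close> with apex \<open>a\<close> is a metrizable space containing \<open>M\<close> as a closed set, so a
  neighbourhood \<open>U\<close> of \<open>M\<close> in it retracts onto \<open>M\<close>.  A ray over a point close to \<open>a\<close> has all its
  points close to the apex, hence in \<open>U\<close>; retracting these short rays contracts a ball about \<open>a\<close>.
\<close>

lemma ANR_semilocally_contractible_at:
  assumes ANR: "metrizable_ANR mtopology" and a: "a \<in> M"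
  shows "\<exists>V. openin mtopology V \<and> a \<in> V \<and> contracts_in mtopology V a"
proof -
  interpret F: Metric_space "Met_TC.fspace M" "Met_TC.fdist M :: ('a \<Rightarrow> real) \<Rightarrow> _"
    by (rule Met_TC.Metric_space_funspace)
  let ?S = "ray a 1 ` M"
  let ?Z = "subtopology F.mtopology (ray_cone a)"
  have SC: "?S \<subseteq> ray_cone a"
    by (auto simp: ray_cone_def)
  interpret MF: Metric_space12 M d "Met_TC.fspace M" "Met_TC.fdist M :: ('a \<Rightarrow> real) \<Rightarrow> _"
    by unfold_locales
  have "embedding_map mtopology F.mtopology (ray a 1)"
    by (rule MF.isometry_imp_embedding_map) (auto simp: a ray_in_fspace fdist_ray_one)
  then have hom: "homeomorphic_map mtopology (subtopology F.mtopology ?S) (ray a 1)"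
    by (simp add: embedding_map_def)
  have ZS: "subtopology ?Z ?S = subtopology F.mtopology ?S"
    using SC by (simp add: subtopology_subtopology Int_absorb1)
  obtain e where e: "continuous_map (subtopology F.mtopology ?S) mtopology e"
    and e_ray: "\<And>y. y \<in> M \<Longrightarrow> e (ray a 1 y) = y"
    using hom unfolding homeomorphic_map_maps homeomorphic_maps_def by auto
  have "subtopology ?Z ?S homeomorphic_space mtopology"
    unfolding ZS by (meson hom homeomorphic_map_imp_homeomorphic_space homeomorphic_space_sym)
  moreover have "metrizable_space ?Z"
    by (intro metrizable_space_subtopology F.metrizable_space_mtopology)
  ultimately obtain U where U: "openin ?Z U" "?S \<subseteq> U" "?S retract_of_space (subtopology ?Z U)"
    using ANR closedin_base_of_ray_cone[OF a] unfolding metrizable_ANR_def by blast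
  obtain r where r: "continuous_map (subtopology ?Z U) (subtopology (subtopology ?Z U) ?S) r"
    and r_S: "\<And>x. x \<in> ?S \<Longrightarrow> r x = x"
    using U(3) unfolding retract_of_space_def by blast
  obtain U' where U': "openin F.mtopology U'" "U = U' \<inter> ray_cone a"
    using U(1) by (auto simp: openin_subtopology)
  have ZU: "subtopology ?Z U = subtopology F.mtopology U"
    using U'(2) by (simp add: subtopology_subtopology Int_absorb1 Int_commute)
  have "ray a 1 a \<in> U'"
    using U(2) U'(2) a by blast
  then obtain \<epsilon> where \<epsilon>: "0 < \<epsilon>" "F.mball (ray a 1 a) \<epsilon> \<subseteq> U'"
    using U'(1) unfolding F.openin_mtopology by blast
  define V where "V = mball a \<epsilon>"
  have V: "openin mtopology V" "a \<in> V"
    using \<epsilon>(1) a by (auto simp: V_def)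
  have rayU: "ray a s y \<in> U" if "y \<in> V" "s \<in> {0..1}" for s y
  proof -
    have y: "y \<in> M" "d a y < \<epsilon>"
      using that by (auto simp: V_def)
    have "ray a 1 a = ray a s a"
      by (auto simp: ray_def)
    moreover have "Met_TC.fdist M (ray a s y) (ray a s a) \<le> s * d y a"
      using fdist_ray_le[of a y a s s] a y that by simp
    moreover have "s * d y a \<le> d a y"
      using that by (simp add: commute[of y] mult_left_le_one_le)
    ultimately have "ray a s y \<in> F.mball (ray a 1 a) \<epsilon>"
      using y a by (simp add: ray_in_fspace F.commute)
    then show ?thesis
      using \<epsilon>(2) U'(2) that y(1) by (auto simp: ray_cone_def)
  qed
  let ?P = "prod_topology (top_of_set {0..1::real}) (subtopology mtopology V)"
  have flip: "continuous_map ?P (prod_topology (top_of_set {0..1::real}) mtopology)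
                (\<lambda>q. (1 - fst q, snd q))"
  proof -
    have "continuous_map ?P euclideanreal (\<lambda>q. 1 - fst q)"
      by (intro continuous_intros continuous_map_into_fulltopology[OF continuous_map_fst])
    then have "continuous_map ?P (top_of_set {0..1::real}) (\<lambda>q. 1 - fst q)"
      by (rule continuous_map_into_subtopology) auto
    then show ?thesis
      by (intro continuous_map_pairedI continuous_map_into_fulltopology[OF continuous_map_snd])
  qed
  have "continuous_map ?P F.mtopology ((\<lambda>(s, y). ray a s y) \<circ> (\<lambda>q. (1 - fst q, snd q)))"
    by (rule continuous_map_compose[OF flip continuous_map_ray[OF a]])
  then have "continuous_map ?P (subtopology F.mtopology U)
               ((\<lambda>(s, y). ray a s y) \<circ> (\<lambda>q. (1 - fst q, snd q)))"
    by (rule continuous_map_into_subtopology) (auto simp: rayU)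
  then have "continuous_map ?P (subtopology F.mtopology ?S)
               (r \<circ> ((\<lambda>(s, y). ray a s y) \<circ> (\<lambda>q. (1 - fst q, snd q))))"
    using continuous_map_compose r U(2) unfolding ZU
    by (fastforce simp: subtopology_subtopology Int_absorb1)
  then have "continuous_map ?P mtopology
               (e \<circ> (r \<circ> ((\<lambda>(s, y). ray a s y) \<circ> (\<lambda>q. (1 - fst q, snd q)))))"
    by (rule continuous_map_compose[OF _ e])
  moreover have "e (r (ray a 1 y)) = y" if "y \<in> M" for y
    using that by (simp add: r_S e_ray)
  moreover have "e (r (ray a 0 y)) = a" if "y \<in> M" for y
  proof -
    have "ray a 0 y = ray a 1 a"
      by (auto simp: ray_def)
    then show ?thesis using a by (simp add: r_S e_ray)
  qed
  ultimately have "contracts_in mtopology V a"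
    unfolding contracts_in_def
    by (subst homotopic_with) (auto intro!: exI simp: comp_def)
  with V show ?thesis by blast
qed

end

lemma metrizable_ANR_imp_semilocally_contractible:
  assumes "metrizable_ANR Y"
  shows "semilocally_contractible Y"
proof -
  obtain M d where M: "Metric_space M d" and Y: "Y = Metric_space.mtopology M d"
    using assms unfolding metrizable_ANR_def metrizable_space_def by blast
  then show ?thesis
    using Metric_space.ANR_semilocally_contractible_at[OF M] assms
    by (simp add: semilocally_contractible_def Metric_space.topspace_mtopology)
qed

section \<open>Path components\<close>

text \<open>
  A contraction moves every point of \<open>V\<close> along a path to \<open>y\<close>, so \<open>V\<close> stays in the path component
  of \<open>y\<close>.
\<close>

lemma openin_path_component_of:
  assumes "semilocally_contractible Y"
  shows "openin Y (path_component_of_set Y b)"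
proof (subst openin_subopen, intro ballI)
  fix y assume y: "y \<in> path_component_of_set Y b"
  then have "y \<in> topspace Y"
    by (simp add: path_component_in_topspace)
  then obtain V where V: "openin Y V" "y \<in> V" "contracts_in Y V y"
    using assms unfolding semilocally_contractible_def by blast
  moreover have "V \<subseteq> path_component_of_set Y b"
    using path_component_of_contraction[OF V(3)] y openin_subset[OF V(1)]
    by (metis mem_Collect_eq path_component_of_sym path_component_of_trans subset_iff)
  ultimately show "\<exists>T. openin Y T \<and> y \<in> T \<and> T \<subseteq> path_component_of_set Y b"
    by blast
qed

lemma closedin_path_component_of:
  assumes "semilocally_contractible Y"
  shows "closedin Y (path_component_of_set Y b)"
proof -
  have "topspace Y - path_component_of_set Y b =
        \<Union>(path_component_of_set Y ` (topspace Y - path_component_of_set Y b))"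
    by (auto simp: path_component_of_refl path_component_in_topspace
        intro: path_component_of_trans path_component_of_sym)
  moreover have "openin Y \<dots>"
    using openin_path_component_of[OF assms] by blast
  ultimately show ?thesis
    by (simp add: closedin_def path_component_of_subset_topspace)
qed

text \<open>
  Path components are clopen.  If \<open>Y\<close> is connected there is only one.  If \<open>X\<close> is connected then a
  continuous map with one value in the component \<open>P\<close> of \<open>f x\<close> has all its values there; this
  applies to almost all approximating maps, and \<open>P\<close> is closed under limits.
\<close>

lemma Baire_one_path_component:
  assumes loc: "semilocally_contractible Y" and conn: "connected_space X \<or> connected_space Y"
    and g: "\<And>n. continuous_map X Y (g n)" and lim: "pointwise_limit X Y g f"
    and x: "x \<in> topspace X" and z: "z \<in> topspace X"
  shows "path_component_of Y (f x) (f z)"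
proof -
  let ?P = "path_component_of_set Y (f x)"
  note op = openin_path_component_of[OF loc, of "f x"]
   and cl = closedin_path_component_of[OF loc, of "f x"]
  have fxP: "f x \<in> ?P" and fz: "f z \<in> topspace Y"
    using lim x z by (auto simp: pointwise_limit_def path_component_of_refl limitin_topspace)
  show ?thesis
    using conn
  proof
    assume "connected_space Y"
    then have "?P = topspace Y"
      using op cl fxP unfolding connected_space_clopen_in by blast
    then show ?thesis using fz by blast
  next
    assume X: "connected_space X"
    have "\<forall>\<^sub>F n in sequentially. g n x \<in> ?P"
      using lim x op fxP unfolding pointwise_limit_def limitin_def by blast
    moreover have "g n z \<in> ?P" if n: "g n x \<in> ?P" for n
    proof -
      let ?A = "{u \<in> topspace X. g n u \<in> ?P}"
      have "openin X ?A" "closedin X ?A"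
        using openin_continuous_map_preimage[OF g op] closedin_continuous_map_preimage[OF g cl]
        by auto
      then have "?A = topspace X"
        using X n x unfolding connected_space_clopen_in by blast
      then show ?thesis using z by blast
    qed
    ultimately have "\<forall>\<^sub>F n in sequentially. g n z \<in> ?P"
      by (rule eventually_mono)
    then have "f z \<in> ?P"
      using limitin_closedin[OF _ cl] lim z unfolding pointwise_limit_def
      by (metis trivial_limit_sequentially)
    then show ?thesis by simp
  qed
qed

section \<open>Countable covers by contracting sets\<close>

text \<open>
  The common end point \<open>b\<close> is essential: contractions of the single pieces then fit together to
  a contraction of the union to one point.
\<close>

lemma contracts_in_disjoint_Union:
  assumes op: "\<And>V. V \<in> \<V> \<Longrightarrow> openin Y V" and con: "\<And>V. V \<in> \<V> \<Longrightarrow> contracts_in Y V b"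
    and disj: "pairwise disjnt \<V>"
  shows "contracts_in Y (\<Union>\<V>) b"
proof -
  let ?I = "top_of_set {0..1::real}"
  let ?P = "prod_topology ?I (subtopology Y (\<Union>\<V>))"
  have "\<forall>V\<in>\<V>. \<exists>h. continuous_map (prod_topology ?I (subtopology Y V)) Y h \<and>
          (\<forall>y. h (0, y) = y) \<and> (\<forall>y. h (1, y) = b)"
    using con unfolding contracts_in_def homotopic_with_def by simp
  then obtain h where h: "\<And>V. V \<in> \<V> \<Longrightarrow> continuous_map (prod_topology ?I (subtopology Y V)) Y (h V)"
    and h0: "\<And>V y. V \<in> \<V> \<Longrightarrow> h V (0, y) = y" and h1: "\<And>V y. V \<in> \<V> \<Longrightarrow> h V (1, y) = b"
    by metis
  have sub: "subtopology ?P ({0..1} \<times> V) = prod_topology ?I (subtopology Y V)" if "V \<in> \<V>" for V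
    using that by (simp add: subtopology_Times subtopology_subtopology Int_absorb1 Union_upper)
  obtain G where G: "continuous_map ?P Y G"
    "\<And>q V. \<lbrakk>V \<in> \<V>; q \<in> topspace ?P \<inter> ({0..1} \<times> V)\<rbrakk> \<Longrightarrow> G q = h V q"
  proof (rule pasting_lemma_exists[of ?P "\<lambda>V. {0..1} \<times> V" \<V> Y h])
    show "topspace ?P \<subseteq> (\<Union>V\<in>\<V>. {0..1} \<times> V)"
      by auto
    show "openin ?P ({0..1} \<times> V)" if "V \<in> \<V>" for V
      using op[OF that] that
      by (auto simp: openin_prod_Times_iff openin_open_subtopology openin_Union op)
    show "continuous_map (subtopology ?P ({0..1} \<times> V)) Y (h V)" if "V \<in> \<V>" for V
      using h[OF that] by (simp only: sub[OF that])
    show "h V q = h W q" if "V \<in> \<V>" "W \<in> \<V>" "q \<in> topspace ?P \<inter> ({0..1} \<times> V) \<inter> ({0..1} \<times> W)"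
      for V W q
    proof -
      have "snd q \<in> V \<inter> W"
        using that(3) by auto
      then have "V = W"
        using that(1,2) disj unfolding pairwise_def disjnt_def by blast
      then show ?thesis by simp
    qed
  qed blast
  have G_V: "G (t, y) = h V (t, y)" if "V \<in> \<V>" "y \<in> V" "0 \<le> t" "t \<le> 1" for t y V
    using G(2)[OF that(1), of "(t, y)"] that op[THEN openin_subset] by auto
  have "G (0, y) = y" "G (1, y) = b" if "y \<in> \<Union>\<V>" for y
    using that G_V h0 h1 by auto
  then show ?thesis
    unfolding contracts_in_def using G(1) by (subst homotopic_with) auto
qed

context Metric_space
begin

text \<open>
  Stone's argument for the paracompactness of metric spaces.  Well-order \<open>\<U>\<close> and, at scale
  \<open>\<rho>\<close>, let \<open>U\<close> be responsible for the points \<open>y\<close> of which it is the first member containing them,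
  provided that the \<open>\<rho>\<close>-ball about \<open>y\<close> fits into \<open>U\<close>.  Points for which different members are
  responsible are at distance at least \<open>\<rho>\<close>, so the balls of radius \<open>\<rho> / 2\<close> about them form
  disjoint open subsets of the members of \<open>\<U>\<close>, and their union contracts to \<open>b\<close>.  Countably
  many scales exhaust \<open>\<Union>\<U>\<close>.
\<close>

lemma Union_contracts_in_countable:
  assumes op: "\<And>U. U \<in> \<U> \<Longrightarrow> openin mtopology U"
    and con: "\<And>U. U \<in> \<U> \<Longrightarrow> contracts_in mtopology U b"
  obtains W :: "nat \<Rightarrow> 'a set" where "\<And>k. openin mtopology (W k)"
    "\<And>k. contracts_in mtopology (W k) b" "(\<Union>k. W k) = \<Union>\<U>"
proof -
  obtain r where r: "well_order_on \<U> r"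
    using well_order_on by blast
  then have wf: "wf (r - Id)" and total: "total_on \<U> r"
    by (auto simp: well_order_on_def linear_order_on_def)
  define \<rho> where "\<rho> k = 1 / real (Suc k)" for k
  define C where "C k U = {y \<in> M. mball y (\<rho> k) \<subseteq> U \<and> (\<forall>U'. (U', U) \<in> r - Id \<longrightarrow> y \<notin> U')}" for k U
  define B where "B k U = (\<Union>y\<in>C k U. mball y (\<rho> k / 2))" for k U
  have \<rho>: "0 < \<rho> k" for k
    by (simp add: \<rho>_def)
  have B_sub: "B k U \<subseteq> U" for k U
  proof -
    have "mball y (\<rho> k / 2) \<subseteq> mball y (\<rho> k)" for y
      using \<rho>[of k] by (intro mball_subset_concentric) auto
    then show ?thesis
      by (fastforce simp: B_def C_def)
  qed
  have B_disj: "B k U \<inter> B k U' = {}" if "(U', U) \<in> r - Id" for k U U'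
  proof (rule ccontr)
    assume "B k U \<inter> B k U' \<noteq> {}"
    then obtain w y y' where w: "w \<in> mball y (\<rho> k / 2)" "w \<in> mball y' (\<rho> k / 2)"
      and y: "y \<in> C k U" "y' \<in> C k U'"
      unfolding B_def by blast
    have "y \<in> mball y' (\<rho> k)"
      using w triangle[of y' w y] by (simp add: commute[of y w])
    then show False
      using y that unfolding C_def by blast
  qed
  show thesis
  proof
    show op_W: "openin mtopology (\<Union>(B k ` \<U>))" for k
      unfolding B_def by (intro openin_Union) auto
    show "contracts_in mtopology (\<Union>(B k ` \<U>)) b" for k
    proof (rule contracts_in_disjoint_Union)
      show "openin mtopology V" if "V \<in> B k ` \<U>" for V
        using that by (auto simp: B_def)
      show "contracts_in mtopology V b" if "V \<in> B k ` \<U>" for V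
        using that con contracts_in_subset[OF _ B_sub] by blast
      have "disjnt (B k U) (B k U')" if "U \<in> \<U>" "U' \<in> \<U>" "U \<noteq> U'" for U U'
        using that total B_disj[of U U' k] B_disj[of U' U k] unfolding total_on_def disjnt_def by blast
      then show "pairwise disjnt (B k ` \<U>)"
        unfolding pairwise_def by blast
    qed
    show "(\<Union>k. \<Union>(B k ` \<U>)) = \<Union>\<U>"
    proof
      show "(\<Union>k. \<Union>(B k ` \<U>)) \<subseteq> \<Union>\<U>"
        using B_sub by blast
      show "\<Union>\<U> \<subseteq> (\<Union>k. \<Union>(B k ` \<U>))"
      proof
        fix y assume "y \<in> \<Union>\<U>"
        then obtain U0 where "U0 \<in> {U \<in> \<U>. y \<in> U}"
          by blast
        then obtain U where U: "U \<in> \<U>" "y \<in> U"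
          and least: "\<And>U'. (U', U) \<in> r - Id \<Longrightarrow> U' \<notin> {U \<in> \<U>. y \<in> U}"
          using wfE_min[OF wf] by (metis (mono_tags, lifting) mem_Collect_eq)
        have "\<forall>U'. (U', U) \<in> r - Id \<longrightarrow> y \<notin> U'"
          using least r by (auto simp: well_order_on_def linear_order_on_def partial_order_on_def
              preorder_on_def refl_on_def)
        obtain \<epsilon> where "0 < \<epsilon>" "mball y \<epsilon> \<subseteq> U" and yM: "y \<in> M"
          using op[OF U(1)] U(2) unfolding openin_mtopology by blast
        then obtain k where "\<rho> k < \<epsilon>"
          unfolding \<rho>_def using nat_approx_posE by (metis)
        then have "mball y (\<rho> k) \<subseteq> U"
          using \<open>mball y \<epsilon> \<subseteq> U\<close> mball_subset_concentric[of "\<rho> k" \<epsilon> y] by auto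
        then have "y \<in> C k U"
          using yM \<open>\<forall>U'. _\<close> by (simp add: C_def)
        then have "y \<in> B k U"
          using \<rho>[of k] yM unfolding B_def by (intro UN_I[of y]) auto
        then show "y \<in> (\<Union>k. \<Union>(B k ` \<U>))"
          using U(1) by blast
      qed
    qed
  qed
qed

lemma openin_cozero:
  assumes "openin mtopology W"
  obtains \<phi> where "continuous_map mtopology euclideanreal \<phi>" "\<And>y. y \<in> M \<Longrightarrow> 0 < \<phi> y \<longleftrightarrow> y \<in> W"
proof -
  \<comment> \<open>The distance to the complement of \<open>W\<close>; the \<open>1\<close> takes care of \<open>W = M\<close>.\<close>
  define \<phi> where "\<phi> y = Inf (insert 1 (d y ` (M - W)))" for y
  have bdd: "bdd_below (insert 1 (d y ` (M - W)))" for y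
    by (rule bdd_belowI[of _ 0]) auto
  have le: "\<phi> y \<le> \<phi> z + d y z" if "y \<in> M" "z \<in> M" for y z
  proof -
    have "\<phi> y - d y z \<le> \<phi> z"
      unfolding \<phi>_def[of z]
    proof (rule cInf_greatest)
      fix c assume c: "c \<in> insert 1 (d z ` (M - W))"
      show "\<phi> y - d y z \<le> c"
      proof (cases "c = 1")
        case True
        have "\<phi> y \<le> 1" unfolding \<phi>_def by (rule cInf_lower[OF _ bdd]) simp
        then show ?thesis using True nonneg[of y z] by linarith
      next
        case False
        then obtain w where w: "w \<in> M - W" "c = d z w" using c by blast
        have "\<phi> y \<le> d y w" unfolding \<phi>_def by (rule cInf_lower[OF _ bdd]) (use w in simp)
        then show ?thesis using w that triangle[of y z w] by auto
      qed
    qed simp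
    then show ?thesis by linarith
  qed
  have "Lipschitz_continuous_map (metric (M, d)) euclidean_metric \<phi>"
    unfolding Lipschitz_continuous_map_def
  proof (intro conjI exI ballI)
    show "mdist euclidean_metric (\<phi> y) (\<phi> z) \<le> 1 * mdist (metric (M, d)) y z"
      if "y \<in> mspace (metric (M, d))" "z \<in> mspace (metric (M, d))" for y z
      using that le[of y z] le[of z y] by (simp add: dist_real_def commute)
  qed auto
  then have "continuous_map mtopology euclideanreal \<phi>"
    using Lipschitz_continuous_imp_continuous_map by fastforce
  moreover have "0 < \<phi> y \<longleftrightarrow> y \<in> W" if y: "y \<in> M" for y
  proof
    assume pos: "0 < \<phi> y"
    show "y \<in> W"
    proof (rule ccontr)
      assume "y \<notin> W"
      then have "d y y \<in> d y ` (M - W)" using y by blast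
      then have "\<phi> y \<le> d y y" unfolding \<phi>_def by (intro cInf_lower[OF _ bdd]) blast
      then show False using pos y by simp
    qed
  next
    assume "y \<in> W"
    then obtain \<epsilon> where \<epsilon>: "0 < \<epsilon>" "mball y \<epsilon> \<subseteq> W"
      using assms unfolding openin_mtopology by blast
    have "min 1 \<epsilon> \<le> \<phi> y"
      unfolding \<phi>_def
    proof (rule cInf_greatest)
      fix c assume c: "c \<in> insert 1 (d y ` (M - W))"
      show "min 1 \<epsilon> \<le> c"
      proof (cases "c = 1")
        case False
        then obtain w where w: "w \<in> M - W" "c = d y w" using c by blast
        then have "w \<notin> mball y \<epsilon>" using \<epsilon>(2) by blast
        then show ?thesis using w y by auto
      qed simp
    qed simp
    then show "0 < \<phi> y" using \<epsilon>(1) by linarith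
  qed
  ultimately show thesis by (rule that)
qed

end

section \<open>Null-homotopic approximation\<close>

text \<open>
  On \<open>C i\<close> the map \<open>p\<close> is pushed to time \<open>s i x\<close> along the contraction of \<open>V i\<close>.  Where
  two pieces meet this time is \<open>1\<close>, all contractions have arrived at \<open>b\<close>, and the pieces agree
  with each other and with the constant \<open>b\<close> on \<open>R\<close>.  Letting the time run on from \<open>s i x\<close> to \<open>1\<close>
  contracts the pasted map.
\<close>

lemma null_homotopic_pasting:
  assumes p: "continuous_map X Y p" and fin: "finite I" and b: "b \<in> topspace Y"
    and clC: "\<And>i. i \<in> I \<Longrightarrow> closedin X (C i)" and clR: "closedin X R"
    and cover: "topspace X \<subseteq> R \<union> (\<Union>i\<in>I. C i)"
    and V: "\<And>i. i \<in> I \<Longrightarrow> contracts_in Y (V i) b" and pV: "\<And>i. i \<in> I \<Longrightarrow> p ` C i \<subseteq> V i"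
    and s: "\<And>i. i \<in> I \<Longrightarrow> continuous_map X (top_of_set {0..1::real}) (s i)"
    and s_C: "\<And>i j x. \<lbrakk>i \<in> I; j \<in> I; i \<noteq> j; x \<in> C i \<inter> C j\<rbrakk> \<Longrightarrow> s i x = 1"
    and s_R: "\<And>i x. \<lbrakk>i \<in> I; x \<in> C i \<inter> R\<rbrakk> \<Longrightarrow> s i x = 1"
  obtains g where "homotopic_with (\<lambda>_. True) X Y g (\<lambda>_. b)"
    "\<And>i x. \<lbrakk>i \<in> I; x \<in> C i; s i x = 0\<rbrakk> \<Longrightarrow> g x = p x"
proof -
  let ?I = "top_of_set {0..1::real}"
  let ?P = "prod_topology ?I X"
  have "\<forall>i\<in>I. \<exists>h. continuous_map (prod_topology ?I (subtopology Y (V i))) Y h \<and>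
          (\<forall>y. h (0, y) = y) \<and> (\<forall>y. h (1, y) = b)"
    using V unfolding contracts_in_def homotopic_with_def by simp
  then obtain h where h: "\<And>i. i \<in> I \<Longrightarrow> continuous_map (prod_topology ?I (subtopology Y (V i))) Y (h i)"
    and h0: "\<And>i y. i \<in> I \<Longrightarrow> h i (0, y) = y" and h1: "\<And>i y. i \<in> I \<Longrightarrow> h i (1, y) = b"
    by metis
  define k where "k i = (\<lambda>q. h i (max (fst q) (s i (snd q)), p (snd q)))" for i
  have C_sub: "C i \<subseteq> topspace X" if "i \<in> I" for i
    using clC[OF that] by (rule closedin_subset)
  have s01: "0 \<le> s i x" "s i x \<le> 1" if "i \<in> I" "x \<in> topspace X" for i x
    using s[OF that(1)] that(2) by (auto simp: continuous_map_def)
  have k: "continuous_map (subtopology ?P ({0..1} \<times> C i)) Y (k i)" if i: "i \<in> I" for i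
  proof -
    let ?Q = "prod_topology ?I (subtopology X (C i))"
    have sC: "continuous_map ?Q X snd"
      by (rule continuous_map_into_fulltopology[OF continuous_map_snd])
    have "continuous_map ?Q euclideanreal (\<lambda>q. max (fst q) (s i (snd q)))"
    proof (intro continuous_map_real_max)
      show "continuous_map ?Q euclideanreal fst"
        by (rule continuous_map_into_fulltopology[OF continuous_map_fst])
      show "continuous_map ?Q euclideanreal (\<lambda>q. s i (snd q))"
        using continuous_map_compose[OF sC continuous_map_into_fulltopology[OF s[OF i]]]
        by (simp add: comp_def)
    qed
    then have "continuous_map ?Q ?I (\<lambda>q. max (fst q) (s i (snd q)))"
      by (rule continuous_map_into_subtopology) (use s01[OF i] in \<open>auto simp: max_def\<close>)
    moreover have "continuous_map ?Q (subtopology Y (V i)) (\<lambda>q. p (snd q))"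
      using continuous_map_compose[OF sC p] pV[OF i]
      by (intro continuous_map_into_subtopology) (auto simp: comp_def)
    ultimately have "continuous_map ?Q (prod_topology ?I (subtopology Y (V i)))
                       (\<lambda>q. (max (fst q) (s i (snd q)), p (snd q)))"
      by (rule continuous_map_pairedI)
    from continuous_map_compose[OF this h[OF i]]
    show ?thesis
      by (simp add: k_def comp_def subtopology_Times subtopology_subtopology)
  qed
  \<comment> \<open>The index \<open>None\<close> stands for the closed set \<open>R\<close>, on which the homotopy is constant.\<close>
  define T where "T = case_option ({0..1::real} \<times> R) (\<lambda>i. {0..1} \<times> C i)"
  define F where "F = case_option (\<lambda>_. b) k"
  have agree: "k i q = k j q" if "i \<in> I" "j \<in> I" "fst q \<le> 1" "snd q \<in> C i \<inter> C j" for i j q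
  proof (cases "i = j")
    case False
    then have "s i (snd q) = 1" "s j (snd q) = 1"
      using s_C[of i j "snd q"] s_C[of j i "snd q"] that by auto
    then show ?thesis
      using that h1 by (simp add: k_def max_absorb2)
  qed simp
  have agree_R: "k i q = b" if "i \<in> I" "fst q \<le> 1" "snd q \<in> C i \<inter> R" for i q
    using s_R[OF that(1,3)] that h1 by (simp add: k_def max_absorb2)
  obtain G where G: "continuous_map ?P Y G"
    "\<And>q i. \<lbrakk>i \<in> insert None (Some ` I); q \<in> topspace ?P \<inter> T i\<rbrakk> \<Longrightarrow> G q = F i q"
  proof (rule pasting_lemma_exists_closed[of "insert None (Some ` I)" ?P T Y F])
    show "finite (insert None (Some ` I))"
      using fin by simp
    show "topspace ?P \<subseteq> (\<Union>i\<in>insert None (Some ` I). T i)"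
    proof
      fix q assume "q \<in> topspace ?P"
      then have "fst q \<in> {0..1}" "snd q \<in> R \<or> (\<exists>i\<in>I. snd q \<in> C i)"
        using cover by auto
      then show "q \<in> (\<Union>i\<in>insert None (Some ` I). T i)"
        by (cases q) (auto simp: T_def)
    qed
    show "closedin ?P (T i)" if "i \<in> insert None (Some ` I)" for i
      using that clC clR by (auto simp: T_def closedin_prod_Times_iff)
    show "continuous_map (subtopology ?P (T i)) Y (F i)" if "i \<in> insert None (Some ` I)" for i
      using that k b by (auto simp: T_def F_def)
    show "F i q = F j q" if "i \<in> insert None (Some ` I)" "j \<in> insert None (Some ` I)"
        "q \<in> topspace ?P \<inter> T i \<inter> T j" for i j q
    proof -
      have "fst q \<le> 1"
        using that(3) by auto
      have R: "snd q \<in> R" if "q \<in> T None"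
        using that by (auto simp: T_def)
      have C: "snd q \<in> C a" if "q \<in> T (Some a)" for a
        using that by (auto simp: T_def)
      show ?thesis
      proof (cases i; cases j)
        fix a c assume ij: "i = Some a" "j = Some c"
        then have "k a q = k c q"
          using that C \<open>fst q \<le> 1\<close> by (intro agree) auto
        then show ?thesis
          by (simp add: ij F_def)
      next
        fix a assume ij: "i = Some a" "j = None"
        then have "k a q = b"
          using that C R \<open>fst q \<le> 1\<close> by (intro agree_R) auto
        then show ?thesis
          by (simp add: ij F_def)
      next
        fix a assume ij: "i = None" "j = Some a"
        then have "k a q = b"
          using that C R \<open>fst q \<le> 1\<close> by (intro agree_R) auto
        then show ?thesis
          by (simp add: ij F_def)
      qed simp
    qed
  qed blast
  have G_C: "G (t, x) = k i (t, x)" if "i \<in> I" "x \<in> C i" "0 \<le> t" "t \<le> 1" for i t x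
    using G(2)[of "Some i" "(t, x)"] that C_sub by (auto simp: T_def F_def)
  have G_1: "G (1, x) = b" if x: "x \<in> topspace X" for x
  proof -
    consider "x \<in> R" | i where "i \<in> I" "x \<in> C i"
      using cover x by blast
    then show ?thesis
    proof cases
      case 1
      then show ?thesis using G(2)[of None "(1, x)"] x by (auto simp: T_def F_def)
    next
      case 2
      then show ?thesis using G_C[of i x 1] s01[OF 2(1) x] h1 by (simp add: k_def max_absorb1)
    qed
  qed
  show thesis
  proof
    show "homotopic_with (\<lambda>_. True) X Y (\<lambda>x. G (0, x)) (\<lambda>_. b)"
      using G(1) G_1 by (subst homotopic_with) auto
    show "G (0, x) = p x" if "i \<in> I" "x \<in> C i" "s i x = 0" for i x
      using G_C[of i x 0] that h0 by (simp add: k_def)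
  qed
qed

text \<open>
  Cover the sets \<open>V\<close> of the last hypothesis by countably many open sets \<open>W k\<close> contracting to \<open>b\<close>, each the set
  where a continuous function \<open>\<phi> k\<close> is positive.  For \<open>i = (k, j)\<close> let \<open>Z i\<close> be the set of the
  \<open>x\<close> with \<open>\<phi> k (f m x) \<ge> 1 / (j + 1)\<close> for all \<open>m \<ge> j\<close>.  Since \<open>f m x\<close> converges to a point of some
  \<open>W k\<close>, these sets cover \<open>X\<close>.  The map \<open>g n\<close> shall agree at \<open>x\<close> with \<open>f n\<close> as soon as stage \<open>n\<close>
  recognizes the first \<open>i\<close> with \<open>x \<in> Z i\<close>; it decides by means of \<open>v n i x\<close>, which measures how
  much \<open>x\<close> has been seen up to stage \<open>n\<close> to violate membership in \<open>Z i\<close>.  This is \<open>0\<close> for \<open>x \<in> Z i\<close>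
  and tends to infinity otherwise.  In between, \<open>g n\<close> moves off to \<open>b\<close>, which separates the
  regions belonging to different \<open>i\<close>.
\<close>

lemma limit_of_null_homotopic:
  assumes Y: "metrizable_space Y" and b: "b \<in> topspace Y"
    and f: "\<And>n. continuous_map X Y (f n)" and lim: "pointwise_limit X Y f f'"
    and loc: "\<And>x. x \<in> topspace X \<Longrightarrow> \<exists>V. openin Y V \<and> f' x \<in> V \<and> contracts_in Y V b"
  obtains g where "\<And>n. homotopic_with (\<lambda>_. True) X Y (g n) (\<lambda>_. b)" "pointwise_limit X Y g f'"
proof -
  obtain M d where M: "Metric_space M d" and Yeq: "Y = Metric_space.mtopology M d"
    using Y unfolding metrizable_space_def by blast
  interpret Metric_space M d by (rule M)
  obtain W where W: "\<And>k. openin Y (W k)" "\<And>k. contracts_in Y (W k) b"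
    and W_cover: "(\<Union>k::nat. W k) = \<Union>{V. openin Y V \<and> contracts_in Y V b}"
    using Union_contracts_in_countable[of "{V. openin Y V \<and> contracts_in Y V b}" b]
    unfolding Yeq by blast
  have "\<forall>k. \<exists>\<phi>. continuous_map Y euclideanreal \<phi> \<and> (\<forall>y\<in>topspace Y. 0 < \<phi> y \<longleftrightarrow> y \<in> W k)"
    using openin_cozero W(1) unfolding Yeq by (metis topspace_mtopology)
  then obtain \<phi> where \<phi>: "\<And>k. continuous_map Y euclideanreal (\<phi> k)"
    and \<phi>_pos: "\<And>k y. y \<in> topspace Y \<Longrightarrow> 0 < \<phi> k y \<longleftrightarrow> y \<in> W k"
    by metis
  have fY: "f n x \<in> topspace Y" if "x \<in> topspace X" for n x
    using f that by (meson continuous_map_def funcset_mem)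
  define K where "K i = fst (prod_decode i)" for i
  define J where "J i = snd (prod_decode i)" for i
  have J_le: "J i \<le> i" for i
    using le_prod_encode_2[of "J i" "K i"] by (simp add: J_def K_def)
  define \<delta> where "\<delta> i m x = max 0 (1 / Suc (J i) - \<phi> (K i) (f m x))" for i m x
  have \<delta>_nonneg: "0 \<le> \<delta> i m x" for i m x
    by (simp add: \<delta>_def)
  \<comment> \<open>The sum never decreases with \<open>n\<close>; the factor \<open>n + 1\<close> makes \<open>v n i x\<close> grow beyond \<open>1\<close> after any
    violation, and lets \<open>v n i x \<le> 1 / 2\<close> force \<open>f n x\<close> into \<open>W (K i)\<close> because \<open>J i \<le> i \<le> n\<close>.\<close>
  define v where "v n i x = real (Suc n) * (\<Sum>m=J i..n. \<delta> i m x)" for n i x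
  have v: "continuous_map X euclideanreal (v n i)" for n i
  proof -
    have "continuous_map X euclideanreal (\<lambda>x. \<phi> (K i) (f m x))" for m
      using continuous_map_compose[OF f \<phi>] by (simp add: comp_def)
    then show ?thesis
      unfolding v_def \<delta>_def by (intro continuous_intros) auto
  qed
  have v_nonneg: "0 \<le> v n i x" for n i x
    unfolding v_def by (intro mult_nonneg_nonneg sum_nonneg \<delta>_nonneg) simp
  \<comment> \<open>\<open>C n i\<close>: at stage \<open>n\<close>, the index \<open>i\<close> is the first that looks admissible, with threshold \<open>1 / 2\<close>.\<close>
  define C where "C n i = {x \<in> topspace X. v n i x \<le> 1 / 2 \<and> (\<forall>j<i. 1 / 2 \<le> v n j x)}" for n i
  define R where "R n = {x \<in> topspace X. \<forall>i\<le>n. 1 / 2 \<le> v n i x}" for n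
  \<comment> \<open>Two indices can both be first only where some \<open>v\<close> equals \<open>1 / 2\<close>, and there \<open>s = 1\<close>; but \<open>s = 0\<close>
    when \<open>v n i x = 0\<close> and every earlier index is refuted with \<open>v n j x \<ge> 1\<close>.\<close>
  define s where "s n i x = min 1 (2 * v n i x + (\<Sum>j<i. max 0 (2 - 2 * v n j x)))" for n i x
  have s: "continuous_map X (top_of_set {0..1}) (s n i)" for n i
  proof (rule continuous_map_into_subtopology)
    show "continuous_map X euclideanreal (s n i)"
      unfolding s_def by (intro continuous_intros v) auto
    show "s n i \<in> topspace X \<rightarrow> {0..1}"
      unfolding s_def using v_nonneg by (auto intro!: add_nonneg_nonneg sum_nonneg)
  qed
  have s_eq_1_self: "s n i x = 1" if "v n i x = 1 / 2" for n i x
  proof -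
    have "0 \<le> (\<Sum>j<i. max 0 (2 - 2 * v n j x))"
      by (intro sum_nonneg) simp
    then show ?thesis
      unfolding s_def using that by simp
  qed
  have s_eq_1_less: "s n i x = 1" if "v n j x = 1 / 2" "j < i" for n i j x
  proof -
    have "max 0 (2 - 2 * v n j x) \<le> (\<Sum>j<i. max 0 (2 - 2 * v n j x))"
      using that(2) by (intro member_le_sum) auto
    then show ?thesis
      unfolding s_def using that(1) v_nonneg[of n i x] by (intro min_absorb1) auto
  qed
  have cl_le: "closedin X {x \<in> topspace X. v n i x \<le> 1 / 2}" for n i
    using closedin_continuous_map_preimage[OF v, of "{..1/2}"] by simp
  have cl_ge: "closedin X {x \<in> topspace X. \<forall>j\<in>A. 1 / 2 \<le> v n j x}" for n A
  proof -
    have "closedin X {x \<in> topspace X. 1 / 2 \<le> v n j x}" for j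
      using closedin_continuous_map_preimage[OF v, of "{1/2..}"] by simp
    then have "closedin X (\<Inter>(insert (topspace X) ((\<lambda>j. {x \<in> topspace X. 1 / 2 \<le> v n j x}) ` A)))"
      by (intro closedin_Inter) auto
    also have "\<Inter>(insert (topspace X) ((\<lambda>j. {x \<in> topspace X. 1 / 2 \<le> v n j x}) ` A)) =
        {x \<in> topspace X. \<forall>j\<in>A. 1 / 2 \<le> v n j x}"
      by auto
    finally show ?thesis .
  qed
  have "\<exists>g. homotopic_with (\<lambda>_. True) X Y g (\<lambda>_. b) \<and>
          (\<forall>i\<le>n. \<forall>x\<in>C n i. s n i x = 0 \<longrightarrow> g x = f n x)" for n
  proof -
    obtain g where "homotopic_with (\<lambda>_. True) X Y g (\<lambda>_. b)"
      "\<And>i x. \<lbrakk>i \<in> {..n}; x \<in> C n i; s n i x = 0\<rbrakk> \<Longrightarrow> g x = f n x"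
    proof (rule null_homotopic_pasting[of X Y "f n" "{..n}" b "C n" "R n" "\<lambda>i. W (K i)" "s n"])
      have "C n i = {x \<in> topspace X. v n i x \<le> 1 / 2} \<inter>
              {x \<in> topspace X. \<forall>j\<in>{..<i}. 1 / 2 \<le> v n j x}" for i
        by (auto simp: C_def)
      note C_eq = this
      show "closedin X (C n i)" for i
        unfolding C_eq by (intro closedin_Int cl_le cl_ge)
      show "closedin X (R n)"
        using cl_ge[of "{..n}" n] by (simp add: R_def Ball_def)
      show "topspace X \<subseteq> R n \<union> (\<Union>i\<in>{..n}. C n i)"
      proof
        fix x assume x: "x \<in> topspace X"
        show "x \<in> R n \<union> (\<Union>i\<in>{..n}. C n i)"
        proof (cases "x \<in> R n")
          case False
          then obtain i where "i \<le> n" "v n i x < 1 / 2"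
            using x by (auto simp: R_def not_le)
          then obtain i where i: "i \<le> n" "v n i x < 1 / 2" "\<And>j. j < i \<Longrightarrow> \<not> v n j x < 1 / 2"
            using exists_least_iff[of "\<lambda>i. v n i x < 1 / 2"] by (metis le_trans not_le less_imp_le)
          then have "x \<in> C n i"
            using x by (auto simp: C_def not_less)
          then show ?thesis using i(1) by blast
        qed simp
      qed
      show "f n ` C n i \<subseteq> W (K i)" if i: "i \<in> {..n}" for i
      proof
        fix y assume "y \<in> f n ` C n i"
        then obtain x where x: "x \<in> topspace X" "v n i x \<le> 1 / 2" "y = f n x"
          by (auto simp: C_def)
        have "J i \<le> n"
          using J_le[of i] i by simp
        then have "\<delta> i n x \<le> (\<Sum>m=J i..n. \<delta> i m x)"
          by (intro member_le_sum) (auto simp: \<delta>_nonneg)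
        then have "real (Suc n) * \<delta> i n x \<le> 1 / 2"
          using x(2) unfolding v_def by (meson mult_left_mono of_nat_0_le_iff order_trans)
        then have "\<delta> i n x \<le> 1 / 2 / real (Suc n)"
          by (subst pos_le_divide_eq) (simp_all only: mult.commute of_nat_0_less_iff zero_less_Suc)
        also have "\<dots> < 1 / real (Suc n)"
          by (intro divide_strict_right_mono) auto
        also have "\<dots> \<le> 1 / real (Suc (J i))"
          using \<open>J i \<le> n\<close> by (intro divide_left_mono) auto
        finally have "0 < \<phi> (K i) (f n x)"
          unfolding \<delta>_def by linarith
        then show "y \<in> W (K i)"
          using \<phi>_pos[OF fY[OF x(1)]] x(3) by blast
      qed
      show "s n i x = 1" if "i \<noteq> j" "x \<in> C n i \<inter> C n j" for i j x
      proof (cases "i < j")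
        case True
        then have "v n i x = 1 / 2"
          using that(2) by (auto simp: C_def intro: antisym)
        then show ?thesis by (rule s_eq_1_self)
      next
        case False
        then have "j < i" using that(1) by simp
        moreover have "v n j x = 1 / 2"
          using that(2) \<open>j < i\<close> by (auto simp: C_def intro: antisym)
        ultimately show ?thesis by (intro s_eq_1_less)
      qed
      show "s n i x = 1" if "i \<in> {..n}" "x \<in> C n i \<inter> R n" for i x
      proof (rule s_eq_1_self)
        show "v n i x = 1 / 2"
          using that by (auto simp: C_def R_def intro: antisym)
      qed
    qed (use f b W(2) s in auto)
    then show ?thesis by auto
  qed
  then obtain g where g: "\<And>n. homotopic_with (\<lambda>_. True) X Y (g n) (\<lambda>_. b)"
    and g_eq: "\<And>n i x. \<lbrakk>i \<le> n; x \<in> C n i; s n i x = 0\<rbrakk> \<Longrightarrow> g n x = f n x"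
    by metis
  have "\<forall>\<^sub>F n in sequentially. f n x = g n x" if x: "x \<in> topspace X" for x
  proof -
    \<comment> \<open>The first index that is never violated at \<open>x\<close> is recognized by all late stages.\<close>
    define Z where "Z i \<longleftrightarrow> (\<forall>m\<ge>J i. \<delta> i m x = 0)" for i
    have "f' x \<in> topspace Y"
      using lim x unfolding pointwise_limit_def limitin_def by blast
    obtain k where k: "f' x \<in> W k"
      using loc[OF x] W_cover by blast
    have lim\<phi>: "(\<lambda>m. \<phi> k (f m x)) \<longlonglongrightarrow> \<phi> k (f' x)"
      using continuous_map_limit[OF \<phi>, of "\<lambda>m. f m x" "f' x" sequentially k] lim x
      unfolding pointwise_limit_def by (simp add: comp_def)
    have "0 < \<phi> k (f' x)"
      using k \<phi>_pos \<open>f' x \<in> topspace Y\<close> by blast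
    then obtain \<epsilon> where "0 < \<epsilon>" "\<epsilon> < \<phi> k (f' x)"
      using dense by blast
    then obtain N where N: "\<And>m. N \<le> m \<Longrightarrow> \<epsilon> < \<phi> k (f m x)"
      using order_tendstoD(1)[OF lim\<phi>] by (meson eventually_sequentially)
    obtain N' where N': "1 / real (Suc N') < \<epsilon>"
      using \<open>0 < \<epsilon>\<close> nat_approx_posE by blast
    have "Z (prod_encode (k, max N N'))"
      unfolding Z_def
    proof (intro allI impI)
      fix m assume m: "J (prod_encode (k, max N N')) \<le> m"
      have "1 / real (Suc (max N N')) \<le> 1 / real (Suc N')"
        by (intro divide_left_mono) auto
      then show "\<delta> (prod_encode (k, max N N')) m x = 0"
        using N[of m] N' m by (simp add: \<delta>_def J_def K_def)
    qed
    then obtain i where i: "Z i" and least: "\<And>j. j < i \<Longrightarrow> \<not> Z j"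
      using exists_least_iff[of Z] by blast
    have v_i: "v n i x = 0" for n
      using i by (simp add: v_def Z_def)
    have v_j: "\<forall>\<^sub>F n in sequentially. 1 \<le> v n j x" if "j < i" for j
    proof -
      obtain m where m: "J j \<le> m" "0 < \<delta> j m x"
        using least[OF \<open>j < i\<close>] \<delta>_nonneg[of j] by (auto simp: Z_def less_le)
      obtain N0 where N0: "1 / real (Suc N0) < \<delta> j m x"
        using m(2) nat_approx_posE by blast
      have "1 \<le> v n j x" if n: "max m N0 \<le> n" for n
      proof -
        have "1 = real (Suc N0) * (1 / real (Suc N0))"
          by simp
        also have "\<dots> \<le> real (Suc n) * \<delta> j m x"
          using n N0 by (intro mult_mono) auto
        also have "\<dots> \<le> v n j x"
          unfolding v_def using n m(1)
          by (intro mult_left_mono member_le_sum) (auto simp: \<delta>_nonneg)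
        finally show ?thesis .
      qed
      then show ?thesis
        unfolding eventually_sequentially by blast
    qed
    have "\<forall>\<^sub>F n in sequentially. \<forall>j<i. 1 \<le> v n j x"
      using eventually_ball_finite[of "{..<i}" "\<lambda>n j. 1 \<le> v n j x" sequentially] v_j
      by (simp add: Ball_def)
    moreover have "\<forall>\<^sub>F n in sequentially. i \<le> n"
      by (rule eventually_ge_at_top)
    ultimately show ?thesis
    proof eventually_elim
      case (elim n)
      have "x \<in> C n i"
        using x v_i elim(1) by (force simp: C_def)
      moreover have "s n i x = 0"
        using v_i elim(1) by (simp add: s_def)
      ultimately show ?case
        using g_eq[OF elim(2)] by simp
    qed
  qed
  then have "pointwise_limit X Y g f'"
    using limitin_transform_eventually lim unfolding pointwise_limit_def by fastforce
  with g show thesis by (rule that)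
qed

text \<open>
  All values of \<open>f\<close> lie in one path component, so neighbourhoods contracting to the points \<open>f z\<close>
  can be contracted further to the single point \<open>b = f x\<close>, for any chosen \<open>x\<close>.
\<close>

lemma Baire_one_imp_limit_of_null_homotopic:
  assumes Y: "metrizable_ANR Y" and conn: "connected_space X \<or> connected_space Y"
    and f: "f \<in> Baire_one X Y"
  obtains b g where "\<And>n. homotopic_with (\<lambda>_. True) X Y (g n) (\<lambda>_. b)" "pointwise_limit X Y g f"
proof -
  obtain h where h: "\<And>n. continuous_map X Y (h n)" and lim: "pointwise_limit X Y h f"
    using f unfolding Baire_one_def by blast
  have loc: "semilocally_contractible Y"
    using Y by (rule metrizable_ANR_imp_semilocally_contractible)
  show thesis
  proof (cases "topspace X = {}")
    case True
    have "homotopic_with (\<lambda>_. True) X Y (h n) (\<lambda>_. b)" for n b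
      by (rule homotopic_with_equal) (use h True in auto)
    then show thesis
      using that lim by blast
  next
    case False
    then obtain x where x: "x \<in> topspace X"
      by blast
    have fY: "f z \<in> topspace Y" if "z \<in> topspace X" for z
      using lim that unfolding pointwise_limit_def by (auto dest: limitin_topspace)
    have near: "\<exists>V. openin Y V \<and> f z \<in> V \<and> contracts_in Y V (f x)" if z: "z \<in> topspace X" for z
      using loc fY[OF z] contracts_in_path_component[OF _ Baire_one_path_component[OF loc conn h lim z x]]
      unfolding semilocally_contractible_def by blast
    have "metrizable_space Y"
      using Y by (simp add: metrizable_ANR_def)
    from limit_of_null_homotopic[OF this fY[OF x] h lim near] that show thesis
      by blast
  qed
qed

theorem theorem4p2:
  fixes X :: "'a topology" and Y :: "'b topology"
  assumes "metrizable_ANR Y"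
    and "connected_space X \<or> connected_space Y"
  shows "Baire_one X Y = homotopical_Baire_one X Y \<and>
         (\<forall>f \<in> Baire_one X Y. \<exists>g. (\<forall>n. null_homotopic X Y (g n)) \<and> pointwise_limit X Y g f)"
proof (intro conjI equalityI subsetI ballI)
  fix f assume f: "f \<in> Baire_one X Y"
  obtain b g where g: "\<And>n. homotopic_with (\<lambda>_. True) X Y (g n) (\<lambda>_. b)"
    and lim: "pointwise_limit X Y g f"
    using Baire_one_imp_limit_of_null_homotopic[OF assms f] by blast
  show "\<exists>g. (\<forall>n. null_homotopic X Y (g n)) \<and> pointwise_limit X Y g f"
    using g lim unfolding null_homotopic_def by blast
  have "homotopic_with (\<lambda>_. True) X Y (g m) (g n)" for m n
    using g by (meson homotopic_with_sym homotopic_with_trans)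
  then show "f \<in> homotopical_Baire_one X Y"
    using g lim homotopic_with_imp_continuous_maps unfolding homotopical_Baire_one_def by blast
next
  fix f assume "f \<in> homotopical_Baire_one X Y"
  then show "f \<in> Baire_one X Y"
    unfolding homotopical_Baire_one_def Baire_one_def by blast
qed

end
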